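(* The generating function $D_2(x)=\sum_{n\ge 0} d_n^{\#2}x^n$ of the sequence $\{d_n^{\#2}\}_{n\geq0}$ is $$D_2(x)= \frac{-5+3\sqrt{1-8x}+3\sqrt{3-4x-2\sqrt{1-8x}}+4x-\sqrt{1-8x}\,\sqrt{3-4x-2\sqrt{1-8x}}}{4}.$$
   Context: The m-implication of type 1 is the connective $\psi\rightharpoonup\phi\equiv\psi\to\neg\phi$, which has value 0 (false) exactly when $\psi$ and $\phi$ both have value 1 (true), and value 1 otherwise. A bracketed formula with $n$ distinct variables is obtained from $p_1\rightharpoonup p_2\rightharpoonup\cdots\rightharpoonup p_n$ (variables in this fixed order) by fully inserting brackets; for $n\ge2$ it has the form $\psi\rightharpoonup\phi$ with $\psi$ a bracketing of $p_1\rightharpoonup\cdots\rightharpoonup p_i$ and $\phi$ a bracketing of $p_{i+1}\rightharpoonup\cdots\rightharpoonup p_n$ for some $1\le i\le n-1$. A row is a pair consisting of a bracketed formula and a valuation of $p_1,\dots,p_n$ in $\{0,1\}$. For $n\ge 2$, $d_n^{\#2}$ is the number of rows (over all bracketed formulae in $n$ variables) for which $\psi$ has value 0 and $\phi$ has value 1 (so that $\psi\rightharpoonup\phi$ is true); $d_0^{\#2}=d_1^{\#2}=0$. Square roots denote formal power series with positive constant term. *)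

theory Defs
  imports Complex_Main "HOL-Computational_Algebra.Formal_Power_Series"
begin

datatype form =
    Var nat
  | MImp form form  (infixr "\<rightharpoonup>\<^sub>m" 65)

(* The truth value of psi -> not phi; True and False stand for 1 and 0. *)
fun value_of :: "(nat \<Rightarrow> bool) \<Rightarrow> form \<Rightarrow> bool" where
  "value_of v (Var i) = v i"
| "value_of v (\<psi> \<rightharpoonup>\<^sub>m \<phi>) = (value_of v \<psi> \<longrightarrow> \<not> value_of v \<phi>)"

(* bracketing i j F: F arises by fully bracketing p_i, p_(i+1), ..., p_j in this order.
   There is no bracketing when j < i. *)
inductive bracketing :: "nat \<Rightarrow> nat \<Rightarrow> form \<Rightarrow> bool" where
  single: "bracketing i i (Var i)"
| split: "bracketing i k \<psi> \<Longrightarrow> bracketing (Suc k) j \<phi> \<Longrightarrow> bracketing i j (\<psi> \<rightharpoonup>\<^sub>m \<phi>)"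

(* Valuations are restricted to the variables p_1, ..., p_n, represented canonically as
   functions that are False outside {1..n}, so that each one is counted exactly once. *)
definition valuations :: "nat \<Rightarrow> (nat \<Rightarrow> bool) set" where
  "valuations n = {v. \<forall>i. i \<notin> {1..n} \<longrightarrow> \<not> v i}"

definition rows :: "nat \<Rightarrow> (form \<times> (nat \<Rightarrow> bool)) set" where
  "rows n = {F. bracketing 1 n F} \<times> valuations n"

definition d2 :: "nat \<Rightarrow> nat" where
  "d2 n = (if n < 2 then 0
     else card {(F, v) \<in> rows n. \<exists>\<psi> \<phi>. F = \<psi> \<rightharpoonup>\<^sub>m \<phi> \<and> \<not> value_of v \<psi> \<and> value_of v \<phi>})"

definition D2 :: "real fps" where
  "D2 = Abs_fps (\<lambda>n. real (d2 n))"

(* The choice of the real root at the constant coefficient selects the square root with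
   positive constant term; see fps_sqrt_unique. *)
definition fps_sqrt :: "real fps \<Rightarrow> real fps" where
  "fps_sqrt a = fps_radical root 2 a"

lemma fps_sqrt_unique:
  assumes "fps_nth a 0 > 0"
  shows "b = fps_sqrt a \<longleftrightarrow> b ^ 2 = a \<and> fps_nth b 0 > 0"
proof -
  have r: "root (Suc 1) (fps_nth a 0) ^ Suc 1 = fps_nth a 0"
    using assms by (intro real_root_pow_pos2) auto
  have "fps_nth (fps_sqrt a) 0 > 0"
    using assms by (simp add: fps_sqrt_def)
  moreover have "fps_sqrt a ^ 2 = a"
    using power_radical[of a root 1] r assms by (simp add: fps_sqrt_def numeral_2_eq_2)
  moreover have "b = c" if "b ^ 2 = c ^ 2" "fps_nth b 0 > 0" "fps_nth c 0 > 0" for b c :: "real fps"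
  proof -
    have "b = c \<or> b = - c"
      using that(1) by (simp add: power2_eq_iff)
    then show ?thesis
      using that by auto
  qed
  ultimately show ?thesis
    by metis
qed

lemma bracketing_le: "bracketing i j F \<Longrightarrow> i \<le> j"
  by (induction rule: bracketing.induct) auto

lemma finite_bracketings: "finite {F. bracketing i j F}"
proof (induction "Suc j - i" arbitrary: i j rule: less_induct)
  case less
  let ?S = "\<lambda>k. (\<lambda>(\<psi>, \<phi>). \<psi> \<rightharpoonup>\<^sub>m \<phi>) ` ({F. bracketing i k F} \<times> {F. bracketing (Suc k) j F})"
  have "{F. bracketing i j F} \<subseteq> insert (Var i) (\<Union>k\<in>{i..<j}. ?S k)"
  proof
    fix F assume "F \<in> {F. bracketing i j F}"
    then have "bracketing i j F" by simp
    then show "F \<in> insert (Var i) (\<Union>k\<in>{i..<j}. ?S k)"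
    proof cases
      case (split k \<psi> \<phi>)
      then have "k \<in> {i..<j}"
        using bracketing_le[OF split(2)] bracketing_le[OF split(3)] by auto
      with split show ?thesis by auto
    qed auto
  qed
  moreover have "finite (?S k)" if "k \<in> {i..<j}" for k
    using that by (intro finite_imageI finite_cartesian_product less) auto
  ultimately show ?case
    by (meson finite_UN_I finite_atLeastLessThan finite_insert finite_subset)
qed

lemma finite_rows: "finite (rows n)"
proof -
  have "v \<in> (\<lambda>A i. i \<in> A) ` Pow {1..n}" if "v \<in> valuations n" for v
    using that by (intro image_eqI[of _ _ "{i. v i}"]) (auto simp: valuations_def)
  then have "finite (valuations n)"
    by (intro finite_subset[of "valuations n" "(\<lambda>A i. i \<in> A) ` Pow {1..n}"]) auto
  then show ?thesis
    unfolding rows_def using finite_bracketings by simp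
qed

end

(*
  Let T and F be the generating functions of the rows with value 1 and 0. A formula has value 0
  iff it is a variable of value 0 or both of its parts have value 1, so F = x + T^2, while
  counting all rows gives T + F = 2x + (T + F)^2. Completing the squares,
  1 - 2(T + F) = sqrt(1 - 8x) and 1 + 2T = sqrt(3 - 4x - 2 sqrt(1 - 8x)); finally D_2 = F T.
*)
theory Submission
  imports Defs
begin

section \<open>Rows over an arbitrary interval of variables, and their splitting\<close>

definition vals_on :: "nat \<Rightarrow> nat \<Rightarrow> (nat \<Rightarrow> bool) set" where
  "vals_on i j = {v. \<forall>k. k \<notin> {i..j} \<longrightarrow> \<not> v k}"

text \<open>The right part of a bracketing starts at a later variable than \<open>p_1\<close>, so a
  recursion over the parts needs rows on every interval \<open>{i..j}\<close>.\<close>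

definition value_rows :: "nat \<Rightarrow> nat \<Rightarrow> bool \<Rightarrow> (form \<times> (nat \<Rightarrow> bool)) set" where
  "value_rows i j b = {(F, v). bracketing i j F \<and> v \<in> vals_on i j \<and> value_of v F = b}"

definition split_rows :: "nat \<Rightarrow> nat \<Rightarrow> bool \<Rightarrow> bool \<Rightarrow> (form \<times> (nat \<Rightarrow> bool)) set" where
  "split_rows i j a b = {(F, v). bracketing i j F \<and> v \<in> vals_on i j \<and>
     (\<exists>\<psi> \<phi>. F = \<psi> \<rightharpoonup>\<^sub>m \<phi> \<and> value_of v \<psi> = a \<and> value_of v \<phi> = b)}"

inductive_cases bracketing_VarE: "bracketing i j (Var k)"
inductive_cases bracketing_MImpE: "bracketing i j (\<psi> \<rightharpoonup>\<^sub>m \<phi>)"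

text \<open>By induction, the left part fixes the first variable and the right part the last. Hence
  the split point of a compound formula can be read off its left part.\<close>

lemma bracketing_unique:
  "bracketing i j F \<Longrightarrow> bracketing i' j' F \<Longrightarrow> i = i' \<and> j = j'"
proof (induction arbitrary: i' j' rule: bracketing.induct)
  case (single i)
  then show ?case by (auto elim: bracketing_VarE)
next
  case (split i k \<psi> j \<phi>)
  from split.prems obtain k' where "bracketing i' k' \<psi>" "bracketing (Suc k') j' \<phi>"
    by (rule bracketing_MImpE)
  with split.IH show ?case by blast
qed

lemma value_of_cong:
  assumes "bracketing i j F" "\<And>k. k \<in> {i..j} \<Longrightarrow> v k = w k"
  shows "value_of v F = value_of w F"
  using assms
proof (induction rule: bracketing.induct)
  case (split i k \<psi> j \<phi>)
  have "i \<le> k" "Suc k \<le> j"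
    using split.hyps bracketing_le by blast+
  then have "value_of v \<psi> = value_of w \<psi>" "value_of v \<phi> = value_of w \<phi>"
    by (auto intro!: split.IH split.prems)
  then show ?case by simp
qed simp

lemma finite_vals_on: "finite (vals_on i j)"
proof -
  have "v \<in> (\<lambda>A i. i \<in> A) ` Pow {i..j}" if "v \<in> vals_on i j" for v
    using that by (intro image_eqI[of _ _ "{i. v i}"]) (auto simp: vals_on_def)
  then show ?thesis
    by (intro finite_subset[of "vals_on i j" "(\<lambda>A i. i \<in> A) ` Pow {i..j}"]) auto
qed

lemma finite_value_rows: "finite (value_rows i j b)"
  by (rule finite_subset[of _ "{F. bracketing i j F} \<times> vals_on i j"])
    (auto simp: value_rows_def finite_bracketings finite_vals_on)

lemma finite_split_rows: "finite (split_rows i j a b)"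
  by (rule finite_subset[of _ "{F. bracketing i j F} \<times> vals_on i j"])
    (auto simp: split_rows_def finite_bracketings finite_vals_on)

text \<open>Such a row amounts to a split point together with one row on each side. Valuations of
  the two sides are glued by disjunction, since each is False outside its own interval, and
  separated again by restriction.\<close>

lemma card_split_rows:
  "card (split_rows i j a b) =
    (\<Sum>k\<in>{i..<j}. card (value_rows i k a) * card (value_rows (Suc k) j b))"
proof -
  define A where "A = (SIGMA k:{i..<j}. value_rows i k a \<times> value_rows (Suc k) j b)"
  define f :: "nat \<times> (form \<times> (nat \<Rightarrow> bool)) \<times> (form \<times> (nat \<Rightarrow> bool)) \<Rightarrow> form \<times> (nat \<Rightarrow> bool)"
    where "f = (\<lambda>(k, (\<psi>, v), (\<phi>, w)). (\<psi> \<rightharpoonup>\<^sub>m \<phi>, \<lambda>n. v n \<or> w n))"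
  \<comment> \<open>The inverse of \<open>f\<close>: the split point is recovered as the right end
    of the interval of the left part. The absent \<open>Var\<close> case is never reached from
    \<open>split_rows\<close>.\<close>
  define g :: "form \<times> (nat \<Rightarrow> bool) \<Rightarrow> nat \<times> (form \<times> (nat \<Rightarrow> bool)) \<times> (form \<times> (nat \<Rightarrow> bool))"
    where "g = (\<lambda>(F, u). case F of \<psi> \<rightharpoonup>\<^sub>m \<phi> \<Rightarrow>
      let k = (THE k. bracketing i k \<psi>)
      in (k, (\<psi>, \<lambda>n. n \<le> k \<and> u n), (\<phi>, \<lambda>n. k < n \<and> u n)))"
  have the: "(THE k. bracketing i k \<psi>) = k" if "bracketing i k \<psi>" for k \<psi>
    using that bracketing_unique by blast
  have gf: "g (f x) = x \<and> f x \<in> split_rows i j a b" if x: "x \<in> A" for x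
  proof -
    obtain k \<psi> v \<phi> w where x_eq: "x = (k, (\<psi>, v), (\<phi>, w))" by (metis prod.exhaust)
    have k: "i \<le> k" "k < j" and b: "bracketing i k \<psi>" "bracketing (Suc k) j \<phi>"
      and v: "\<forall>n. n \<notin> {i..k} \<longrightarrow> \<not> v n" and w: "\<forall>n. n \<notin> {Suc k..j} \<longrightarrow> \<not> w n"
      and val: "value_of v \<psi> = a" "value_of w \<phi> = b"
      using x by (auto simp: A_def x_eq value_rows_def vals_on_def)
    have "value_of (\<lambda>n. v n \<or> w n) \<psi> = value_of v \<psi>"
      using w by (intro value_of_cong[OF b(1)]) auto
    moreover have "value_of (\<lambda>n. v n \<or> w n) \<phi> = value_of w \<phi>"
      using v by (intro value_of_cong[OF b(2)]) auto
    \<comment> \<open>Here \<open>v\<close> is False beyond \<open>k\<close> and \<open>w\<close> is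
      False up to \<open>k\<close>, so cutting the disjunction at \<open>k\<close> returns
      both.\<close>
    moreover have "(n \<le> k \<and> (v n \<or> w n)) = v n" "(k < n \<and> (v n \<or> w n)) = w n" for n
      using spec[OF v, of n] spec[OF w, of n] by auto
    moreover have "(\<lambda>n. v n \<or> w n) \<in> vals_on i j"
      using v w k by (auto simp: vals_on_def)
    ultimately show ?thesis
      using b val by (auto simp: x_eq f_def g_def the[OF b(1)] split_rows_def intro: bracketing.split)
  qed
  have fg: "f (g y) = y \<and> g y \<in> A" if y: "y \<in> split_rows i j a b" for y
  proof -
    obtain \<psi> \<phi> u where y_eq: "y = (\<psi> \<rightharpoonup>\<^sub>m \<phi>, u)" and br: "bracketing i j (\<psi> \<rightharpoonup>\<^sub>m \<phi>)"
      and u: "\<forall>n. n \<notin> {i..j} \<longrightarrow> \<not> u n" and val: "value_of u \<psi> = a" "value_of u \<phi> = b"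
      using y by (auto simp: split_rows_def vals_on_def)
    from br obtain k where b: "bracketing i k \<psi>" "bracketing (Suc k) j \<phi>"
      by (rule bracketing_MImpE)
    have "value_of (\<lambda>n. n \<le> k \<and> u n) \<psi> = value_of u \<psi>"
      by (intro value_of_cong[OF b(1)]) auto
    moreover have "value_of (\<lambda>n. k < n \<and> u n) \<phi> = value_of u \<phi>"
      by (intro value_of_cong[OF b(2)]) auto
    moreover have "(\<lambda>n. n \<le> k \<and> u n \<or> k < n \<and> u n) = u"
      by (auto simp: fun_eq_iff)
    moreover have "(\<lambda>n. n \<le> k \<and> u n) \<in> vals_on i k" "(\<lambda>n. k < n \<and> u n) \<in> vals_on (Suc k) j"
      using u by (auto simp: vals_on_def)
    ultimately show ?thesis
      using b val bracketing_le[OF b(1)] bracketing_le[OF b(2)]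
      by (simp add: y_eq f_def g_def the[OF b(1)] A_def value_rows_def)
  qed
  have "bij_betw f A (split_rows i j a b)"
    using gf fg by (intro bij_betwI[of f _ _ g]) auto
  then have "card (split_rows i j a b) = card A"
    by (simp add: bij_betw_same_card)
  also have "\<dots> = (\<Sum>k\<in>{i..<j}. card (value_rows i k a) * card (value_rows (Suc k) j b))"
    by (simp add: A_def finite_value_rows card_cartesian_product)
  finally show ?thesis .
qed

section \<open>Recurrences for rows of a given value, and invariance under translation\<close>

lemma value_rows_empty: "j < i \<Longrightarrow> value_rows i j b = {}"
  using bracketing_le by (fastforce simp: value_rows_def)

text \<open>A split would need two nonempty intervals, so only the variable itself remains, and
  prescribing its value fixes the valuation.\<close>

lemma card_value_rows_single: "card (value_rows i i b) = 1"
proof -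
  have F: "bracketing i i F \<longleftrightarrow> F = Var i" for F
  proof
    assume "bracketing i i F"
    then show "F = Var i"
    proof cases
      case (split k \<psi> \<phi>)
      then show ?thesis
        using bracketing_le[OF split(2)] bracketing_le[OF split(3)] by simp
    qed
  qed (simp add: bracketing.single)
  have v: "v \<in> vals_on i i \<and> v i = b \<longleftrightarrow> v = (\<lambda>k. k = i \<and> b)" for v
    unfolding vals_on_def atLeastAtMost_singleton fun_eq_iff mem_Collect_eq singleton_iff by metis
  have "value_rows i i b = {(G, v). G = Var i \<and> v \<in> vals_on i i \<and> v i = b}"
    unfolding value_rows_def F by (intro Collect_cong) (auto split: prod.split)
  also have "\<dots> = {(Var i, \<lambda>k. k = i \<and> b)}"
    unfolding v by auto
  finally show ?thesis by simp
qed

lemma bracketing_MImp: "bracketing i j F \<Longrightarrow> i < j \<Longrightarrow> \<exists>\<psi> \<phi>. F = \<psi> \<rightharpoonup>\<^sub>m \<phi>"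
  by (erule bracketing.cases) auto

lemma card_value_rows_False:
  assumes "i < j"
  shows "card (value_rows i j False) = card (split_rows i j True True)"
proof -
  have "value_rows i j False = split_rows i j True True"
    using bracketing_MImp[OF _ assms] by (fastforce simp: value_rows_def split_rows_def)
  then show ?thesis by simp
qed

lemma card_value_rows_True:
  assumes "i < j"
  shows "card (value_rows i j True) = card (split_rows i j False False) +
    card (split_rows i j False True) + card (split_rows i j True False)"
proof -
  have "value_rows i j True =
      split_rows i j False False \<union> split_rows i j False True \<union> split_rows i j True False"
    using bracketing_MImp[OF _ assms] by (fastforce simp: value_rows_def split_rows_def)
  moreover have "split_rows i j False False \<inter> split_rows i j False True = {}"
    "(split_rows i j False False \<union> split_rows i j False True) \<inter> split_rows i j True False = {}"
    by (auto simp: split_rows_def)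
  ultimately show ?thesis
    by (simp add: card_Un_disjoint finite_split_rows)
qed

text \<open>The recurrences depend on \<open>i\<close> and \<open>j\<close> only through the length
  of the interval, so strong induction on \<open>j - i\<close> gives this without renaming variables
  in formulae.\<close>

lemma card_value_rows_shift:
  "card (value_rows (i + m) (j + m) b) = card (value_rows i j b)"
proof (induction "j - i" arbitrary: i j b rule: less_induct)
  case less
  consider "j < i" | "i = j" | "i < j" by linarith
  then show ?case
  proof cases
    case 3
    have "card (split_rows (i + m) (j + m) a b) = card (split_rows i j a b)" for a b
    proof -
      have "card (value_rows (i + m) (k + m) a) = card (value_rows i k a)"
        "card (value_rows (Suc (k + m)) (j + m) b) = card (value_rows (Suc k) j b)"
        if "k \<in> {i..<j}" for k
        using that less[of k i a] less[of j "Suc k" b] by auto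
      then show ?thesis
        by (simp add: card_split_rows sum.shift_bounds_nat_ivl)
    qed
    with 3 show ?thesis
      by (cases b) (simp_all add: card_value_rows_True card_value_rows_False)
  qed (simp_all add: value_rows_empty card_value_rows_single)
qed

section \<open>Generating functions and their equations\<close>

definition value_gf :: "bool \<Rightarrow> real fps" where
  "value_gf b = Abs_fps (\<lambda>n. real (card (value_rows 1 n b)))"

lemma value_gf_nth_0 [simp]: "fps_nth (value_gf b) 0 = 0"
  by (simp add: value_gf_def value_rows_empty)

lemma value_gf_nth_1 [simp]: "fps_nth (value_gf b) (Suc 0) = 1"
  using card_value_rows_single[of 1] by (simp add: value_gf_def)

text \<open>Translating the right part to start at \<open>p_1\<close> turns the sum over split
  points into a Cauchy product.\<close>

lemma card_split_rows_gf:
  "real (card (split_rows 1 n a b)) = fps_nth (value_gf a * value_gf b) n"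
proof -
  have "card (value_rows (Suc k) n b) = card (value_rows 1 (n - k) b)" if "k < n" for k
    using card_value_rows_shift[of 1 k "n - k" b] that by simp
  then have "real (card (split_rows 1 n a b)) =
      (\<Sum>k\<in>{1..<n}. fps_nth (value_gf a) k * fps_nth (value_gf b) (n - k))"
    by (simp add: card_split_rows value_gf_def)
  \<comment> \<open>The added terms \<open>k = 0\<close> and \<open>k = n\<close> vanish because
    both series have constant coefficient 0.\<close>
  also have "\<dots> = (\<Sum>k\<in>{0..n}. fps_nth (value_gf a) k * fps_nth (value_gf b) (n - k))"
    by (rule sum.mono_neutral_left) (auto simp: not_less le_Suc_eq Suc_le_eq)
  finally show ?thesis by (simp add: fps_mult_nth)
qed

lemma value_gf_mult_nth_1: "fps_nth (value_gf a * value_gf b) (Suc 0) = 0"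
  by (simp add: fps_mult_nth)

text \<open>\<open>fps_X\<close> accounts for the single variable; the product only starts in degree
  2, where the recurrence for compound formulae takes over.\<close>

lemma value_gf_False: "value_gf False = fps_X + value_gf True * value_gf True"
proof (rule fps_ext)
  fix n
  consider "n = 0" | "n = Suc 0" | "1 < n" by linarith
  then show "fps_nth (value_gf False) n = fps_nth (fps_X + value_gf True * value_gf True) n"
  proof cases
    case 3
    then have "fps_nth (value_gf False) n = real (card (split_rows 1 n True True))"
      by (simp add: value_gf_def card_value_rows_False)
    with 3 show ?thesis by (simp only: card_split_rows_gf) simp
  qed (simp_all add: value_gf_mult_nth_1)
qed

lemma value_gf_True:
  "value_gf True = fps_X + value_gf False * value_gf False + value_gf False * value_gf True
    + value_gf True * value_gf False" (is "_ = ?R")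
proof (rule fps_ext)
  fix n
  consider "n = 0" | "n = Suc 0" | "1 < n" by linarith
  then show "fps_nth (value_gf True) n = fps_nth ?R n"
  proof cases
    case 3
    then have "fps_nth (value_gf True) n = real (card (split_rows 1 n False False)) +
        real (card (split_rows 1 n False True)) + real (card (split_rows 1 n True False))"
      by (simp add: value_gf_def card_value_rows_True)
    with 3 show ?thesis by (simp only: card_split_rows_gf fps_add_nth) simp
  qed (simp_all add: value_gf_mult_nth_1)
qed

lemma D2_eq_mult: "D2 = value_gf False * value_gf True"
proof (rule fps_ext)
  fix n
  consider "n = 0" | "n = Suc 0" | "1 < n" by linarith
  then show "fps_nth D2 n = fps_nth (value_gf False * value_gf True) n"
  proof cases
    case 3
    then have "d2 n = card (split_rows 1 n False True)"
      unfolding d2_def split_rows_def rows_def valuations_def vals_on_def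
      by (auto intro!: arg_cong[where f = card])
    then show ?thesis by (simp add: D2_def card_split_rows_gf[symmetric])
  qed (simp_all add: D2_def d2_def value_gf_mult_nth_1)
qed

theorem proposition6p6:
  shows "D2 =
    (- 5 + 3 * fps_sqrt (1 - 8 * fps_X)
      + 3 * fps_sqrt (3 - 4 * fps_X - 2 * fps_sqrt (1 - 8 * fps_X))
      + 4 * fps_X
      - fps_sqrt (1 - 8 * fps_X) * fps_sqrt (3 - 4 * fps_X - 2 * fps_sqrt (1 - 8 * fps_X))) / 4"
proof -
  define T where "T = value_gf True"
  define F where "F = value_gf False"
  have F: "F = fps_X + T * T"
    unfolding T_def F_def by (rule value_gf_False)
  have T: "T = fps_X + F * F + F * T + T * F"
    unfolding T_def F_def by (rule value_gf_True)
  have zero: "fps_nth T 0 = 0" "fps_nth F 0 = 0"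
    by (simp_all add: T_def F_def)
  \<comment> \<open>In the sum of the equations \<open>T\<close> and \<open>F\<close>, the products
    for all four pairs of truth values combine to \<open>(T + F) ^ 2\<close>.\<close>
  have all_rows: "T + F = 2 * fps_X + (T + F) ^ 2"
    by (subst T, subst (2) F) (simp add: power2_eq_square algebra_simps)
  have "(1 - 2 * (T + F)) ^ 2 = 1 - 4 * ((T + F) - (T + F) ^ 2)"
    by (simp add: power2_eq_square algebra_simps)
  also have "(T + F) - (T + F) ^ 2 = 2 * fps_X"
    using all_rows by (simp add: algebra_simps)
  finally have "(1 - 2 * (T + F)) ^ 2 = 1 - 8 * fps_X"
    by simp
  \<comment> \<open>The constant coefficient of \<open>1 - 2 * (T + F)\<close> is 1, which selects
    the positive root.\<close>
  then have s: "1 - 2 * (T + F) = fps_sqrt (1 - 8 * fps_X)"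
    by (intro fps_sqrt_unique[THEN iffD2] conjI) (simp_all add: zero)
  \<comment> \<open>Substituting \<open>T * T = F - fps_X\<close> turns
    \<open>1 + 4 * T + 4 * T * T\<close> into \<open>1 + 4 * (T + F) - 4 * fps_X\<close>.\<close>
  have "(1 + 2 * T) ^ 2 = 3 - 4 * fps_X - 2 * (1 - 2 * (T + F))"
    by (simp add: F power2_eq_square algebra_simps)
  then have r: "1 + 2 * T = fps_sqrt (3 - 4 * fps_X - 2 * (1 - 2 * (T + F)))"
    by (intro fps_sqrt_unique[THEN iffD2] conjI) (simp_all add: zero)
  \<comment> \<open>Let s and r be the two square roots. The product s r equals
    \<open>1 - 2 * F - 4 * T * T - 4 * F * T\<close>; replacing \<open>T * T\<close> by
    \<open>F - fps_X\<close> leaves the linear term \<open>- 6 * F\<close>, and \<open>2 * F\<close>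
    is 2 - s - r.\<close>
  have F_T: "4 * (F * T) = - 5 + 3 * (1 - 2 * (T + F)) + 3 * (1 + 2 * T) + 4 * fps_X
      - (1 - 2 * (T + F)) * (1 + 2 * T)"
    by (simp add: F algebra_simps)
  have "D2 = 4 * (F * T) / 4"
    unfolding D2_eq_mult T_def F_def by (rule nonzero_mult_div_cancel_left[symmetric]) simp
  then show ?thesis
    by (simp only: F_T s r)
qed

end
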